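(* Let $n\ge1$. Define $\mathrm{suc}:\mathbb N^n\to\mathbb N^n$ by, for a symbol $\sigma$ and a word $w$ of length $n-1$, $$\mathrm{suc}(\sigma w)=\begin{cases} w(\sigma+1) & \text{if } \mathrm{last}((\sigma+1)w),\\ w0 & \text{if } \neg\mathrm{last}((\sigma+1)w)\text{ and } \mathrm{last}(\sigma w),\\ w\sigma & \text{otherwise}.\end{cases}$$ Then $\mathrm{suc}$ is a shift rule for $\overline{\mathrm{pmx}}(n)$: for every $v\in\mathbb N^n$, $\mathrm{suc}(v)$ is the immediate successor of $v$ in $\overline{\mathrm{pmx}}(n)$.
   Context: $\mathbb N=\{0,1,\dots\}$, $[k]=\{0,\dots,k-1\}$; $\sigma^t$ denotes $t$ repetitions of $\sigma$; $R$ reverses a word. A rotation of $xy$ is $yx$. For words of equal length, $w_1\le_{\mathrm{colex}} w_2$ means $R(w_1)$ is lexicographically $\le R(w_2)$. A key-word is a length-$n$ word colex-maximal among its rotations. For $u\in\mathbb N^n$, $\mathrm{last}(u)$ is the predicate: $u=0^n$, or $u=(\sigma+1)w0^l$ where $0^l(\sigma+1)w$ is a key-word ($l\ge0$, $\sigma$ a symbol), i.e. $u$ is obtained from the key-word among its rotations by moving that key-word's leading block of zeros to the end. The prefer-max sequence $\mathrm{pmx}(n,k)=(w_0,\dots,w_{k^n-1})$ is produced by the greedy algorithm starting with $w_0=0^{n-1}(k-1)$ and repeatedly, while possible, choosing as next word $x\tau$, where the current word is $\sigma x$, with $\tau$ the maximal symbol such that $x\tau$ has not been chosen yet. Its reverse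 $\overline{\mathrm{pmx}}(n,k)$ is $(u_0,\dots,u_{k^n-1})$ with $u_i=R(w_{k^n-1-i})$. For each $k$, $\overline{\mathrm{pmx}}(n,k)$ is a prefix of $\overline{\mathrm{pmx}}(n,k+1)$, and $\overline{\mathrm{pmx}}(n)=\bigcup_{k\ge1}\overline{\mathrm{pmx}}(n,k)$ denotes the resulting ordering of $\mathbb N^n$ ($u$ before $v$ iff $u$ precedes $v$ in some $\overline{\mathrm{pmx}}(n,k)$). *)

theory Defs
  imports "HOL-Library.While_Combinator" "HOL-Library.List_Lexorder"
begin

text \<open>
  A word of length \<open>n\<close> over the symbols \<open>0, 1, 2, \<dots>\<close> is a \<^typ>\<open>nat list\<close> of length \<open>n\<close>.
  On \<^typ>\<open>nat list\<close>, \<open>\<le>\<close> is the lexicographic order of \<^theory>\<open>HOL-Library.List_Lexorder\<close>.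
\<close>

definition colex_le :: "nat list \<Rightarrow> nat list \<Rightarrow> bool" where
  "colex_le w1 w2 \<longleftrightarrow> rev w1 \<le> rev w2"

definition key_word :: "nat list \<Rightarrow> bool" where
  "key_word w \<longleftrightarrow> (\<forall>x y. w = x @ y \<longrightarrow> colex_le (y @ x) w)"

definition is_last :: "nat list \<Rightarrow> bool" where
  "is_last u \<longleftrightarrow>
     u = replicate (length u) 0 \<or>
     (\<exists>\<sigma> w l. u = (\<sigma> + 1) # w @ replicate l 0 \<and> key_word (replicate l 0 @ (\<sigma> + 1) # w))"

text \<open>
  The greedy algorithm keeps the list \<open>ws\<close> of the words chosen so far; the current word is
  \<^term>\<open>last ws\<close>. The loop terminates for \<open>n \<ge> 1\<close>, \<open>k \<ge> 1\<close>, since it only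
  appends new words from a finite set.
\<close>

definition free_symbols :: "nat \<Rightarrow> nat list list \<Rightarrow> nat set" where
  "free_symbols k ws = {\<tau>. \<tau> < k \<and> tl (last ws) @ [\<tau>] \<notin> set ws}"

definition pmx :: "nat \<Rightarrow> nat \<Rightarrow> nat list list" where
  "pmx n k =
     while (\<lambda>ws. free_symbols k ws \<noteq> {})
           (\<lambda>ws. ws @ [tl (last ws) @ [Max (free_symbols k ws)]])
           [replicate (n - 1) 0 @ [k - 1]]"

definition rev_pmx :: "nat \<Rightarrow> nat \<Rightarrow> nat list list" where
  "rev_pmx n k = map rev (rev (pmx n k))"

definition rev_pmx_less :: "nat \<Rightarrow> nat list \<Rightarrow> nat list \<Rightarrow> bool" where
  "rev_pmx_less n u v \<longleftrightarrow>
     (\<exists>k\<ge>1. \<exists>i j. i < j \<and> j < length (rev_pmx n k) \<and> rev_pmx n k ! i = u \<and> rev_pmx n k ! j = v)"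

definition immediate_successor :: "('a \<Rightarrow> 'a \<Rightarrow> bool) \<Rightarrow> 'a \<Rightarrow> 'a \<Rightarrow> bool" where
  "immediate_successor prec v u \<longleftrightarrow> prec v u \<and> \<not> (\<exists>w. prec v w \<and> prec w u)"

text \<open>The value on the empty word is a dummy; the map is meant for words of length \<open>n \<ge> 1\<close>.\<close>

fun suc :: "nat list \<Rightarrow> nat list" where
  "suc [] = []"
| "suc (\<sigma> # w) =
     (if is_last ((\<sigma> + 1) # w) then w @ [\<sigma> + 1]
      else if is_last (\<sigma> # w) then w @ [0]
      else w @ [\<sigma>])"

end

(* Work with reversed words, so that key-words become the lexicographically largest rotations.
   There the shift rule is an injective map "step" whose orbit starting at 0^n is shown to have two
   properties: it exhausts the words over [k], ending with 0^(n-1)(k-1), before using larger symbols,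
   and it visits w0, w1, w2, ... in this order for every w of length n-1. The greedy choice of the
   maximal unused symbol therefore traverses the orbit backwards. Both properties follow from a
   time stamp of words that is nondecreasing along the orbit and strictly increasing from
   w s to w (s+1). *)

theory Submission
  imports Defs
begin

section \<open>Lexicographic order on words\<close>

lemma append_less_append:
  fixes a b c d :: "nat list"
  assumes "a < b" "length a = length b"
  shows "a @ c < b @ d"
  using assms(2,1) by (induction rule: list_induct2) auto

lemma append_le_append_same_iff:
  fixes a b c :: "nat list"
  shows "c @ a \<le> c @ b \<longleftrightarrow> a \<le> b"
  by (induction c) auto

lemma append_less_append_same_iff:
  fixes a b c :: "nat list"
  shows "c @ a < c @ b \<longleftrightarrow> a < b"
  by (induction c) auto

lemma append_le_appendD:
  fixes a b c d :: "nat list"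
  assumes "a @ c \<le> b @ d" "length a = length b"
  shows "a \<le> b"
  using append_less_append[of b a d c] assms by (force simp: not_less[symmetric])

lemma replicate_mono:
  fixes a b :: nat
  assumes "a \<le> b"
  shows "replicate l a \<le> replicate l b"
  using assms by (induction l) auto

section \<open>Rotations\<close>

definition rotations :: "'a list \<Rightarrow> 'a list set" where
  "rotations r = range (\<lambda>i. rotate i r)"

lemma rotations_iff: "s \<in> rotations r \<longleftrightarrow> (\<exists>x y. r = x @ y \<and> s = y @ x)"
proof
  assume "s \<in> rotations r"
  then obtain i where "s = drop (i mod length r) r @ take (i mod length r) r"
    unfolding rotations_def rotate_drop_take by blast
  then show "\<exists>x y. r = x @ y \<and> s = y @ x"
    by (metis append_take_drop_id)
next
  assume "\<exists>x y. r = x @ y \<and> s = y @ x"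
  then obtain x y where "r = x @ y" "s = y @ x" by blast
  then show "s \<in> rotations r"
    unfolding rotations_def by (auto simp: rotate_append intro: range_eqI[of _ _ "length x"])
qed

lemma rotations_append: "rotations (y @ x) = rotations (x @ y)"
proof -
  have "rotations (y @ x) \<subseteq> rotations (x @ y)" for x y :: "'a list"
  proof -
    have "rotate i (y @ x) = rotate (i + length x) (x @ y)" for i
      by (simp add: rotate_append flip: rotate_rotate)
    then show ?thesis unfolding rotations_def by auto
  qed
  then show ?thesis by blast
qed

lemma finite_rotations: "finite (rotations r)"
proof -
  have "rotations r \<subseteq> (\<lambda>i. drop i r @ take i r) ` {..length r}"
  proof
    fix s assume "s \<in> rotations r"
    then obtain x y where "r = x @ y" "s = y @ x" unfolding rotations_iff by blast
    then show "s \<in> (\<lambda>i. drop i r @ take i r) ` {..length r}"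
      by (intro image_eqI[of _ _ "length x"]) auto
  qed
  then show ?thesis using finite_surj by blast
qed

lemma self_in_rotations: "r \<in> rotations r"
  unfolding rotations_iff by (metis append_Nil append_Nil2)

definition max_rotation :: "nat list \<Rightarrow> nat list" where
  "max_rotation r = Max (rotations r)"

definition lex_max :: "nat list \<Rightarrow> bool" where
  "lex_max r \<longleftrightarrow> (\<forall>x y. r = x @ y \<longrightarrow> y @ x \<le> r)"

lemma max_rotation_in: "max_rotation r \<in> rotations r"
  unfolding max_rotation_def using Max_in[OF finite_rotations] self_in_rotations by blast

lemma le_max_rotation: "s \<in> rotations r \<Longrightarrow> s \<le> max_rotation r"
  unfolding max_rotation_def using Max_ge[OF finite_rotations] .

lemma max_rotation_append: "max_rotation (y @ x) = max_rotation (x @ y)"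
  unfolding max_rotation_def by (simp add: rotations_append[of y x])

lemma lex_max_iff: "lex_max r \<longleftrightarrow> max_rotation r = r"
proof
  assume "lex_max r"
  then have "max_rotation r \<le> r"
    using max_rotation_in[of r] unfolding lex_max_def rotations_iff by auto
  then show "max_rotation r = r" using le_max_rotation[OF self_in_rotations, of r] by simp
next
  assume "max_rotation r = r"
  then show "lex_max r" unfolding lex_max_def
    using le_max_rotation[of _ r] by (auto simp: rotations_iff)
qed

lemma lex_max_max_rotation: "lex_max (max_rotation r)"
proof -
  obtain x y where "r = x @ y" "max_rotation r = y @ x"
    using max_rotation_in[of r] unfolding rotations_iff by blast
  then show ?thesis unfolding lex_max_iff by (metis max_rotation_append)
qed

text \<open>Reversal turns the colexicographic order into the lexicographic one and maps the
  rotations of \<open>v\<close> onto those of \<open>rev v\<close>.\<close>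

lemma key_word_iff: "key_word v \<longleftrightarrow> lex_max (rev v)"
proof
  assume k: "key_word v"
  show "lex_max (rev v)" unfolding lex_max_def
  proof (intro allI impI)
    fix x y assume "rev v = x @ y"
    then have "v = rev y @ rev x" by (metis rev_append rev_rev_ident)
    then have "rev (rev x @ rev y) \<le> rev v"
      using k unfolding key_word_def colex_le_def by blast
    then show "y @ x \<le> rev v" by simp
  qed
next
  assume k: "lex_max (rev v)"
  then show "key_word v"
    unfolding lex_max_def key_word_def colex_le_def by auto
qed

text \<open>The rotation starting at an occurrence of \<open>a\<close> is at most \<open>r\<close>;
  comparing first symbols suffices.\<close>

lemma lex_max_hd:
  assumes "lex_max r" "a \<in> set r"
  shows "a \<le> hd r"
proof -
  obtain x y where r: "r = x @ a # y" using assms(2) split_list by metis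
  then have "a # y @ x \<le> r" using assms(1) unfolding lex_max_def by fastforce
  moreover obtain b s where "r = b # s" using r by (cases x) auto
  ultimately show ?thesis by auto
qed

section \<open>The shift rule on reversed words\<close>

abbreviation zeros :: "nat list \<Rightarrow> nat list" where
  "zeros w \<equiv> takeWhile ((=) 0) w"

abbreviation core :: "nat list \<Rightarrow> nat list" where
  "core w \<equiv> dropWhile ((=) 0) w"

text \<open>Mirror image of \<open>is_last\<close> for the reversed word
  \<open>w @ [\<sigma>]\<close>. Only the zeros leading \<open>w\<close> are moved, and \<sigma>
  keeps its place even when it is 0, so for fixed \<open>w\<close> the tested words differ in a
  single position.\<close>

definition closes :: "nat list \<Rightarrow> nat \<Rightarrow> bool" where
  "closes w \<sigma> \<longleftrightarrow> lex_max (core w @ \<sigma> # zeros w)"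

lemma zeros_eq_replicate: "zeros w = replicate (length (zeros w)) 0"
  by (metis (mono_tags, lifting) replicate_eqI set_takeWhileD)

lemma zeros_core_cases:
  obtains l z where "w = replicate l 0 @ z" "zeros w = replicate l 0" "core w = z"
    "z = [] \<or> hd z > 0"
proof
  show "w = replicate (length (zeros w)) 0 @ core w"
    using zeros_eq_replicate by (metis takeWhile_dropWhile_id)
  show "core w = [] \<or> hd (core w) > 0"
    by (metis (mono_tags, lifting) bot_nat_0.not_eq_extremum hd_dropWhile)
qed (use zeros_eq_replicate in auto)

lemma zeros_core_replicate_append:
  assumes "z = [] \<or> hd z > 0"
  shows "zeros (replicate l 0 @ z) = replicate l 0" "core (replicate l 0 @ z) = z"
  using assms by (induction l) (auto simp: takeWhile_eq_Nil_iff dropWhile_eq_self_iff)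

lemma closes_replicate_append:
  assumes "z = [] \<or> hd z > 0"
  shows "closes (replicate l 0 @ z) \<sigma> \<longleftrightarrow> lex_max (z @ \<sigma> # replicate l 0)"
  unfolding closes_def by (simp only: zeros_core_replicate_append[OF assms])

text \<open>For \<sigma> = 0 all rotations coincide; for \<sigma> > 0 every proper rotation begins
  with 0.\<close>

lemma lex_max_single: "lex_max (\<sigma> # replicate l 0)"
  unfolding lex_max_def
proof (intro allI impI)
  fix x y assume e: "\<sigma> # replicate l 0 = x @ y"
  show "y @ x \<le> \<sigma> # replicate l 0"
  proof (cases x)
    case Nil
    then show ?thesis using e by simp
  next
    case (Cons a x')
    then have "replicate l 0 = x' @ y" "a = \<sigma>" using e by auto
    then obtain i j where xy: "x' = replicate i 0" "y = replicate j 0" "l = i + j"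
      by (metis append_eq_conv_conj drop_replicate length_append length_replicate take_replicate
          append_take_drop_id)
    show ?thesis
    proof (cases "\<sigma> = 0")
      case True
      then have "y @ x = replicate (j + Suc i) 0"
        unfolding replicate_add using Cons \<open>a = \<sigma>\<close> xy by simp
      also have "\<dots> = \<sigma> # replicate l 0" using True xy(3) by (simp add: add.commute)
      finally show ?thesis by simp
    next
      case False
      then show ?thesis using Cons \<open>a = \<sigma>\<close> xy by (cases j) auto
    qed
  qed
qed

lemma closes_zeros: "core w = [] \<Longrightarrow> closes w \<sigma>"
  unfolding closes_def using lex_max_single zeros_eq_replicate by (metis append_Nil)

text \<open>A rotation starting inside the final zeros is smaller because its first symbol is \<open>0\<close>; in any
  other proper rotation the lowered symbol stands further left than in the word itself.\<close>

lemma lex_max_lower: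
  assumes m: "lex_max (z @ \<tau> # replicate l 0)" and z: "z \<noteq> []" "hd z > 0" and lt: "\<tau>' < \<tau>"
  shows "lex_max (z @ \<tau>' # replicate l 0)"
  unfolding lex_max_def
proof (intro allI impI)
  let ?r = "z @ \<tau>' # replicate l 0"
  fix x y assume e: "?r = x @ y"
  consider (in_core) z2 where "z = x @ z2" "y = z2 @ \<tau>' # replicate l 0" "x \<noteq> []"
    | (at_symbol) "x = z" "y = \<tau>' # replicate l 0"
    | (triv) "x = []"
    | (in_zeros) x' where "x = z @ \<tau>' # x'" "replicate l 0 = x' @ y"
    using e by (auto simp: append_eq_append_conv2 append_eq_Cons_conv Cons_eq_append_conv)
  then show "y @ x \<le> ?r"
  proof cases
    case in_core
    \<comment> \<open>Cutting \<open>z\<close> at the length of \<open>z2\<close> aligns the start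
      of the rotation with the start of the word.\<close>
    define a b where "a = take (length z2) z" and "b = drop (length z2) z"
    have ab: "z = a @ b" "length a = length z2"
      unfolding a_def b_def append_take_drop_id using in_core by auto
    have r: "?r = a @ (b @ \<tau>' # replicate l 0)" using ab(1) by simp
    have yx: "y @ x = z2 @ (\<tau>' # replicate l 0 @ x)" using in_core(2) by simp
    have "length z2 < length z" using in_core(1,3) by simp
    then have bne: "b \<noteq> []" unfolding b_def by simp
    have le: "z2 @ (\<tau> # replicate l 0 @ x) \<le> a @ (b @ \<tau> # replicate l 0)"
      using m in_core ab(1) unfolding lex_max_def
      by (metis append.assoc append_Cons)
    then have "z2 \<le> a" using append_le_appendD ab(2) by metis
    then consider "z2 < a" | "z2 = a" by fastforce
    then show ?thesis
    proof cases
      case 1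
      then have "z2 @ (\<tau>' # replicate l 0 @ x) < a @ (b @ \<tau>' # replicate l 0)"
        using append_less_append ab(2) by metis
      then show ?thesis unfolding r yx by (rule less_imp_le)
    next
      case 2
      obtain c b' where b: "b = c # b'" using bne by (cases b) auto
      \<comment> \<open>With equal beginnings, the maximality in \<open>m\<close> compares \<tau>
        with the next symbol \<open>c\<close> of \<open>z\<close>; the lowered symbol is then
        strictly below \<open>c\<close>.\<close>
      have "\<tau> \<le> c" using le 2 b by (auto simp: append_le_append_same_iff)
      then have "z2 @ (\<tau>' # replicate l 0 @ x) < a @ (b @ \<tau>' # replicate l 0)"
        using lt b 2 by (simp add: append_less_append_same_iff)
      then show ?thesis unfolding r yx by (rule less_imp_le)
    qed
  next
    case at_symbol
    have "\<tau> \<le> hd z" using lex_max_hd[OF m, of \<tau>] z by simp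
    then show ?thesis using at_symbol lt z by (cases z) auto
  next
    case triv
    then show ?thesis using e by simp
  next
    case in_zeros
    show ?thesis
    proof (cases y)
      case Nil
      then show ?thesis using e by simp
    next
      case (Cons c y')
      then have "c = 0" using in_zeros(2) by (metis in_set_conv_decomp in_set_replicate)
      then show ?thesis using Cons z by (cases z) auto
    qed
  qed
qed

text \<open>Hence the symbols closing \<open>w\<close> form an initial segment of the naturals. An
  all-zero \<open>w\<close> is treated separately because \<open>lex_max_lower\<close> compares with
  a positive first symbol.\<close>

lemma closes_mono:
  assumes "closes w \<tau>" "\<tau>' \<le> \<tau>"
  shows "closes w \<tau>'"
proof (cases "core w = [] \<or> \<tau>' = \<tau>")
  case True
  then show ?thesis using closes_zeros assms by auto
next
  case False
  obtain l z where w: "w = replicate l 0 @ z" "core w = z" and hz: "z = [] \<or> hd z > 0"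
    by (rule zeros_core_cases)
  have "lex_max (z @ \<tau> # replicate l 0)"
    using assms(1) closes_replicate_append[OF hz] w(1) by simp
  then have "lex_max (z @ \<tau>' # replicate l 0)"
    by (rule lex_max_lower) (use hz False w(2) assms(2) in simp_all)
  then show ?thesis using closes_replicate_append[OF hz] w(1) by simp
qed

section \<open>Agreement of the reversed shift rule with \<open>is_last\<close> and
  \<open>suc\<close>\<close>

lemma is_last_iff_closes: "is_last ((\<sigma> + 1) # rev w) \<longleftrightarrow> closes w (\<sigma> + 1)"
proof
  assume "is_last ((\<sigma> + 1) # rev w)"
  then obtain w' l where rw: "rev w = w' @ replicate l 0"
    and k: "key_word (replicate l 0 @ (\<sigma> + 1) # w')"
    unfolding is_last_def by auto
  have w: "w = replicate l 0 @ rev w'"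
    using rw by (metis rev_append rev_replicate rev_rev_ident)
  have m: "lex_max (rev w' @ (\<sigma> + 1) # replicate l 0)"
    using k unfolding key_word_iff by simp
  \<comment> \<open>A largest rotation containing the positive symbol \<sigma> + 1 starts with a
    positive symbol, so the \<open>l\<close> zeros are all the leading zeros of
    \<open>w\<close>.\<close>
  have "rev w' = [] \<or> hd (rev w') > 0"
    using lex_max_hd[OF m, of "\<sigma> + 1"] by (cases "rev w'") auto
  then show "closes w (\<sigma> + 1)" using closes_replicate_append w m by metis
next
  assume c: "closes w (\<sigma> + 1)"
  obtain l z where w: "w = replicate l 0 @ z" and hz: "z = [] \<or> hd z > 0"
    by (rule zeros_core_cases)
  have "lex_max (z @ (\<sigma> + 1) # replicate l 0)"
    using c closes_replicate_append[OF hz] w by simp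
  then have "key_word (replicate l 0 @ (\<sigma> + 1) # rev z)"
    unfolding key_word_iff by simp
  then show "is_last ((\<sigma> + 1) # rev w)"
    unfolding is_last_def using w by auto
qed

definition next_symbol :: "nat list \<Rightarrow> nat \<Rightarrow> nat" where
  "next_symbol w \<sigma> =
     (if closes w (\<sigma> + 1) then \<sigma> + 1 else if closes w \<sigma> then 0 else \<sigma>)"

definition step :: "nat list \<Rightarrow> nat list" where
  "step r = next_symbol (butlast r) (last r) # butlast r"

lemma step_snoc [simp]: "step (w @ [\<sigma>]) = next_symbol w \<sigma> # w"
  unfolding step_def by simp

lemma length_step: "r \<noteq> [] \<Longrightarrow> length (step r) = length r"
  unfolding step_def by simp

text \<open>For \<open>\<sigma> = 0\<close> the last two branches of both definitions agree, so it does not matter that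
  \<^const>\<open>is_last\<close> is narrower than \<^const>\<open>closes\<close> there.\<close>

lemma suc_rev:
  assumes "r \<noteq> []"
  shows "suc (rev r) = rev (step r)"
proof -
  obtain w \<sigma> where r: "r = w @ [\<sigma>]" using assms rev_exhaust by blast
  have 1: "is_last (Suc \<sigma> # rev w) \<longleftrightarrow> closes w (Suc \<sigma>)" for \<sigma>
    using is_last_iff_closes by simp
  show ?thesis unfolding r
    by (cases \<sigma>) (auto simp: 1 next_symbol_def)
qed

text \<open>On the initial segment of symbols closing \<open>w\<close>, \<open>next_symbol\<close>
  is a cyclic permutation if the segment is finite and the successor map otherwise; all other
  symbols are fixed.\<close>

lemma inj_next_symbol:
  assumes "next_symbol w \<sigma> = next_symbol w \<sigma>'"
  shows "\<sigma> = \<sigma>'"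
proof -
  have neq: "next_symbol w a \<noteq> next_symbol w b" if "a < b" for a b
    using that closes_mono[of w b 0] closes_mono[of w b "a + 1"] closes_mono[of w "b + 1" "a + 1"]
    unfolding next_symbol_def by (auto split: if_splits)
  show ?thesis using neq[of \<sigma> \<sigma>'] neq[of \<sigma>' \<sigma>] assms by (cases \<sigma> \<sigma>' rule: linorder_cases) auto
qed

lemma step_inj:
  assumes "step r = step r'" "r \<noteq> []" "r' \<noteq> []"
  shows "r = r'"
  using assms inj_next_symbol unfolding step_def
  by (metis append_butlast_last_id list.inject)

text \<open>A preimage of the zero word would have an all-zero prefix. Every symbol closes such a
  prefix, so the new symbol would be a successor.\<close>

lemma step_neq_zero: "r \<noteq> [] \<Longrightarrow> step r \<noteq> replicate n 0"
proof
  assume "r \<noteq> []" and e: "step r = replicate n 0"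
  then obtain m where w: "butlast r = replicate m 0" "next_symbol (butlast r) (last r) = 0"
    unfolding step_def by (cases n) auto
  then have "closes (butlast r) (last r + 1)" by (intro closes_zeros) auto
  then show False using w(2) unfolding next_symbol_def by simp
qed

section \<open>A time stamp for the orbit\<close>

text \<open>The orbit enters the rotation class of a word at the lexicographic rank of the largest
  rotation. A word \<open>0\<^sup>l z \<sigma>\<close> whose rotation \<open>z \<sigma> 0\<^sup>l\<close> is largest is reached only after the
  classes of all largest rotations \<open>z \<sigma> y\<close> have been traversed; hence the \<open>l\<close>-fold padding with a
  symbol \<open>B\<close> exceeding all others.\<close>

definition stamp :: "nat \<Rightarrow> nat list \<Rightarrow> nat list" where
  "stamp B r = (let w = butlast r; \<sigma> = last r in
     if closes w \<sigma> then core w @ \<sigma> # replicate (length (zeros w)) B else max_rotation r)"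

lemma stamp_closes:
  "closes w \<sigma> \<Longrightarrow> stamp B (w @ [\<sigma>]) = core w @ \<sigma> # replicate (length (zeros w)) B"
  unfolding stamp_def by simp

lemma stamp_not_closes:
  "\<not> closes w \<sigma> \<Longrightarrow> stamp B (w @ [\<sigma>]) = max_rotation (w @ [\<sigma>])"
  unfolding stamp_def by simp

lemma canonical_in_rotations: "core w @ \<sigma> # zeros w \<in> rotations (w @ [\<sigma>])"
  unfolding rotations_iff
  by (rule exI[of _ "zeros w"], rule exI[of _ "core w @ [\<sigma>]"]) simp

lemma max_rotation_closes:
  assumes "closes w \<sigma>"
  shows "max_rotation (w @ [\<sigma>]) = core w @ \<sigma> # zeros w"
proof -
  have "max_rotation (w @ [\<sigma>]) = max_rotation ((core w @ [\<sigma>]) @ zeros w)"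
    by (metis append.assoc max_rotation_append takeWhile_dropWhile_id)
  then show ?thesis using assms unfolding closes_def lex_max_iff by simp
qed

lemma max_rotation_le_stamp:
  assumes "r \<noteq> []"
  shows "max_rotation r \<le> stamp B r"
proof -
  obtain w \<sigma> where r: "r = w @ [\<sigma>]" using assms rev_exhaust by blast
  have "zeros w \<le> replicate (length (zeros w)) B"
    using zeros_eq_replicate replicate_mono by (metis le0)
  then show ?thesis unfolding r
    by (cases "closes w \<sigma>")
      (simp_all add: stamp_closes stamp_not_closes max_rotation_closes append_le_append_same_iff)
qed

text \<open>Raising \<sigma> leads to a class with a larger maximum, dropping it to 0 turns \<sigma>
  into one more padding symbol \<open>B\<close>, and a plain rotation stays in its class, whose
  maximum bounds all its stamps from below.\<close>

lemma stamp_step: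
  assumes "\<sigma> < B"
  shows "closes w \<sigma> \<and> stamp B (w @ [\<sigma>]) < stamp B (step (w @ [\<sigma>])) \<or>
    \<not> closes w \<sigma> \<and> step (w @ [\<sigma>]) = \<sigma> # w \<and> stamp B (w @ [\<sigma>]) \<le> stamp B (step (w @ [\<sigma>]))"
proof -
  consider (up) "closes w (\<sigma> + 1)" "closes w \<sigma>"
    | (drop) "\<not> closes w (\<sigma> + 1)" "closes w \<sigma>"
    | (rot) "\<not> closes w (\<sigma> + 1)" "\<not> closes w \<sigma>"
    using closes_mono by fastforce
  then show ?thesis
  proof cases
    case up
    have "stamp B (w @ [\<sigma>]) = core w @ \<sigma> # replicate (length (zeros w)) B"
      using stamp_closes up by simp
    \<comment> \<open>The raised symbol decides the comparison before the padding is
      reached.\<close>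
    also have "\<dots> < core w @ (\<sigma> + 1) # zeros w"
      by (simp add: append_less_append_same_iff)
    also have "\<dots> = max_rotation ((\<sigma> + 1) # w)"
      using max_rotation_closes[OF up(1)] max_rotation_append[of w "[\<sigma> + 1]"] by simp
    also have "\<dots> \<le> stamp B ((\<sigma> + 1) # w)" by (rule max_rotation_le_stamp) simp
    finally show ?thesis using up by (simp add: next_symbol_def)
  next
    case drop
    obtain l z where w: "w = replicate l 0 @ z" "zeros w = replicate l 0" "core w = z"
      and hz: "z = [] \<or> hd z > 0" by (rule zeros_core_cases)
    have "z \<noteq> []" using closes_zeros drop(1) w by metis
    then obtain z' \<tau> where z: "z = z' @ [\<tau>]" using rev_exhaust by blast
    have hz': "z' = [] \<or> hd z' > 0" using hz unfolding z by (cases z') auto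
    have s: "step (w @ [\<sigma>]) = (replicate (Suc l) 0 @ z') @ [\<tau>]"
      using drop unfolding step_snoc next_symbol_def w(1) z by simp
    \<comment> \<open>The canonical rotation of the new word is
      \<open>z @ 0 # replicate l 0\<close>, so the new last symbol closes its prefix exactly because
      0 closes \<open>w\<close>.\<close>
    have "closes w 0" using drop(2) closes_mono by blast
    then have "lex_max (z @ 0 # replicate l 0)"
      unfolding w(1) closes_replicate_append[OF hz] .
    then have "closes (replicate (Suc l) 0 @ z') \<tau>"
      unfolding closes_replicate_append[OF hz'] z by simp
    then have "stamp B (step (w @ [\<sigma>])) = z' @ \<tau> # replicate (Suc l) B"
      unfolding s by (simp only: stamp_closes zeros_core_replicate_append[OF hz'] length_replicate)
    moreover have "stamp B (w @ [\<sigma>]) = z' @ \<tau> # \<sigma> # replicate l B"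
      using stamp_closes[OF drop(2)] w z by simp
    ultimately show ?thesis using drop assms by (simp add: append_less_append_same_iff)
  next
    case rot
    then have s: "step (w @ [\<sigma>]) = \<sigma> # w" by (simp add: next_symbol_def)
    have "stamp B (w @ [\<sigma>]) = max_rotation (\<sigma> # w)"
      using stamp_not_closes[OF rot(2)] max_rotation_append[of w "[\<sigma>]"] by simp
    also have "\<dots> \<le> stamp B (\<sigma> # w)" by (rule max_rotation_le_stamp) simp
    finally show ?thesis using rot s by simp
  qed
qed

text \<open>In the largest rotation of \<open>w @ [\<sigma>]\<close>, raising the symbol that came
  from the end gives a larger word, which is a rotation of
  \<open>w @ [Suc \<sigma>]\<close>.\<close>

lemma max_rotation_less_Suc: "max_rotation (w @ [\<sigma>]) < max_rotation (w @ [Suc \<sigma>])"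
proof -
  obtain x y where xy: "w @ [\<sigma>] = x @ y" and m: "max_rotation (w @ [\<sigma>]) = y @ x"
    using max_rotation_in[of "w @ [\<sigma>]"] unfolding rotations_iff by blast
  show ?thesis
  proof (cases y rule: rev_cases)
    case Nil
    then have "max_rotation (w @ [\<sigma>]) = w @ [\<sigma>]" using m xy by simp
    also have "\<dots> < w @ [Suc \<sigma>]" by (simp add: append_less_append_same_iff)
    also have "\<dots> \<le> max_rotation (w @ [Suc \<sigma>])"
      by (intro le_max_rotation self_in_rotations)
    finally show ?thesis .
  next
    case (snoc y' b)
    then have w: "w = x @ y'" "b = \<sigma>" using xy by auto
    have "max_rotation (w @ [\<sigma>]) = y' @ \<sigma> # x" using m snoc w(2) by simp
    also have "\<dots> < y' @ Suc \<sigma> # x" by (simp add: append_less_append_same_iff)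
    also have "\<dots> \<le> max_rotation (w @ [Suc \<sigma>])"
      unfolding w by (intro le_max_rotation, unfold rotations_iff)
        (rule exI[of _ x], rule exI[of _ "y' @ [Suc \<sigma>]"], simp)
    finally show ?thesis .
  qed
qed

text \<open>If \<sigma> closes \<open>w\<close>, the raised symbol outweighs the padding behind it.
  Otherwise \<open>Suc \<sigma>\<close> does not close \<open>w\<close> either, and both stamps are
  largest rotations.\<close>

lemma stamp_less_Suc: "stamp B (w @ [\<sigma>]) < stamp B (w @ [Suc \<sigma>])"
proof (cases "closes w \<sigma>")
  case True
  have "stamp B (w @ [\<sigma>]) < core w @ Suc \<sigma> # zeros w"
    unfolding stamp_closes[OF True] by (simp add: append_less_append_same_iff)
  also have "\<dots> \<le> max_rotation (w @ [Suc \<sigma>])"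
    by (intro le_max_rotation canonical_in_rotations)
  also have "\<dots> \<le> stamp B (w @ [Suc \<sigma>])" by (rule max_rotation_le_stamp) simp
  finally show ?thesis .
next
  case False
  then have "\<not> closes w (Suc \<sigma>)" using closes_mono le_SucI by blast
  then show ?thesis using False max_rotation_less_Suc by (simp add: stamp_not_closes)
qed

lemma stamp_less:
  assumes "\<sigma> < \<sigma>'"
  shows "stamp B (w @ [\<sigma>]) < stamp B (w @ [\<sigma>'])"
  using lift_Suc_mono_less[of "\<lambda>\<sigma>. stamp B (w @ [\<sigma>])" \<sigma> \<sigma>'] stamp_less_Suc assms by blast

text \<open>Moving the trailing zeros of the largest rotation to its front gives such a word, unless
  all symbols are 0; then the word itself serves.\<close>

lemma ex_rotation_closes:
  assumes "r \<noteq> []"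
  obtains w \<sigma> where "w @ [\<sigma>] \<in> rotations r" "closes w \<sigma>"
proof (cases "set r \<subseteq> {0}")
  case True
  obtain w \<sigma> where r: "r = w @ [\<sigma>]" using assms rev_exhaust by blast
  then have "closes w \<sigma>" using True by (intro closes_zeros) auto
  then show ?thesis using that self_in_rotations r by blast
next
  case False
  let ?m = "max_rotation r"
  obtain x y where xy: "r = x @ y" "?m = y @ x"
    using max_rotation_in[of r] unfolding rotations_iff by blast
  obtain a where a: "a \<in> set ?m" "a > 0" using False xy by auto
  \<comment> \<open>Applied to the reversal, the split at leading zeros isolates the trailing zeros
    of \<open>?m\<close>.\<close>
  obtain k u where u: "rev ?m = replicate k 0 @ u" "u = [] \<or> hd u > 0"
    by (rule zeros_core_cases)
  have "u \<noteq> []" using u(1) a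
    by (metis append_Nil2 in_set_replicate less_irrefl set_rev)
  then obtain \<tau> u' where u': "u = \<tau> # u'" by (cases u) auto
  have "rev (rev ?m) = rev u' @ \<tau> # replicate k 0" unfolding u(1) u' by simp
  then have m: "?m = rev u' @ \<tau> # replicate k 0" by simp
  have lm: "lex_max (rev u' @ \<tau> # replicate k 0)" using lex_max_max_rotation m by metis
  have "rev u' = [] \<or> hd (rev u') > 0"
    using lex_max_hd[OF lm, of \<tau>] u(2) u' by (cases "rev u'") auto
  then have "closes (replicate k 0 @ rev u') \<tau>" using closes_replicate_append lm by metis
  moreover have "(replicate k 0 @ rev u') @ [\<tau>] \<in> rotations ?m"
    unfolding m rotations_iff by (rule exI[of _ "rev u' @ [\<tau>]"], rule exI[of _ "replicate k 0"]) simp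
  then have "(replicate k 0 @ rev u') @ [\<tau>] \<in> rotations r"
    using xy rotations_append by metis
  ultimately show ?thesis using that by blast
qed

section \<open>The orbit of the zero word\<close>

definition words :: "nat \<Rightarrow> nat \<Rightarrow> nat list set" where
  "words n k = {r. set r \<subseteq> {..<k} \<and> length r = n}"

lemma finite_words: "finite (words n k)"
  unfolding words_def by (rule finite_lists_length_eq) simp

definition orbit :: "nat \<Rightarrow> nat \<Rightarrow> nat list" where
  "orbit n i = (step ^^ i) (replicate n 0)"

lemma orbit_0: "orbit n 0 = replicate n 0"
  unfolding orbit_def by simp

lemma orbit_Suc: "orbit n (Suc i) = step (orbit n i)"
  unfolding orbit_def by simp

text \<open>Only raising can leave the alphabet. A closing \<sigma> + 1 is at most the first symbol
  of \<open>core w\<close>; if \<open>w\<close> is all zeros, the excluded word rules out \<sigma> =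
  k - 1.\<close>

lemma next_symbol_less:
  assumes "w @ [\<sigma>] \<in> words n k" "w @ [\<sigma>] \<noteq> replicate (n - 1) 0 @ [k - 1]"
  shows "next_symbol w \<sigma> < k"
proof (cases "closes w (\<sigma> + 1)")
  case False
  then show ?thesis using assms(1) by (auto simp: next_symbol_def words_def)
next
  case True
  obtain l z where w: "w = replicate l 0 @ z" "zeros w = replicate l 0" "core w = z"
    and hz: "z = [] \<or> hd z > 0" by (rule zeros_core_cases)
  have "\<sigma> + 1 < k"
  proof (cases "z = []")
    case True
    then show ?thesis using assms w(1) by (auto simp: words_def)
  next
    case False
    have "\<sigma> + 1 \<le> hd z"
      using lex_max_hd[OF True[unfolded closes_def], of "\<sigma> + 1"] w(3) False by simp
    moreover have "hd z < k" using False assms(1) unfolding w(1) words_def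
      by (auto simp: subset_iff)
    ultimately show ?thesis by simp
  qed
  then show ?thesis using True by (simp add: next_symbol_def)
qed

lemma step_in_words:
  assumes "r \<in> words n k" "r \<noteq> replicate (n - 1) 0 @ [k - 1]" "n \<ge> 1"
  shows "step r \<in> words n k"
proof -
  have "r \<noteq> []" using assms unfolding words_def by auto
  then obtain w \<sigma> where r: "r = w @ [\<sigma>]" using rev_exhaust by blast
  show ?thesis using next_symbol_less[of w \<sigma> n k] assms unfolding r by (auto simp: words_def)
qed

lemma stamp_step_words:
  assumes "r \<in> words n k" "n \<ge> 1"
  shows "stamp k r \<le> stamp k (step r)"
proof -
  have "r \<noteq> []" using assms unfolding words_def by auto
  then obtain w \<sigma> where r: "r = w @ [\<sigma>]" using rev_exhaust by blast
  then have "\<sigma> < k" using assms unfolding words_def by auto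
  then show ?thesis using stamp_step[of \<sigma> k w] r by auto
qed

text \<open>Otherwise the stamp would become constant, the orbit would then run through all rotations of
  one word, and among these is one at which the stamp increases.\<close>

lemma reaches_end:
  assumes n: "n \<ge> 1" and r: "r \<in> words n k"
  shows "\<exists>i. (step ^^ i) r = replicate (n - 1) 0 @ [k - 1] \<and> (\<forall>j\<le>i. (step ^^ j) r \<in> words n k)"
proof -
  let ?e = "replicate (n - 1) 0 @ [k - 1]"
  define h where "h i = (step ^^ i) r" for i
  have hS: "h (Suc i) = step (h i)" for i unfolding h_def by simp
  have ex: "\<exists>i. h i = ?e"
  proof (rule ccontr)
    assume ne: "\<nexists>i. h i = ?e"
    have hw: "h i \<in> words n k" for i
    proof (induction i)
      case 0
      then show ?case using r by (simp add: h_def)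
    next
      case (Suc i)
      then show ?case using step_in_words ne n hS by metis
    qed
    define t where "t i = stamp k (h i)" for i
    have mono: "t i \<le> t j" if "i \<le> j" for i j
      using that by (rule lift_Suc_mono_le[of t, rotated])
        (use stamp_step_words[OF hw n] in \<open>simp add: t_def hS\<close>)
    have fin: "finite (range t)"
      by (rule finite_subset[of _ "stamp k ` words n k"]) (use hw finite_words in \<open>auto simp: t_def\<close>)
    have "Max (range t) \<in> range t" using Max_in[OF fin] by simp
    then obtain i0 where i0: "t i0 = Max (range t)" by (metis imageE)
    \<comment> \<open>A nondecreasing sequence stays constant once it has attained its
      maximum.\<close>
    have const: "t j = t i0" if "j \<ge> i0" for j
      using mono[OF that] i0 Max_ge[OF fin, of "t j"] by simp
    \<comment> \<open>A constant stamp excludes the strict alternative of \<open>stamp_step\<close>,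
      so only plain rotations remain.\<close>
    have rot: "\<not> closes w \<sigma> \<and> h (Suc j) = \<sigma> # w" if "j \<ge> i0" "h j = w @ [\<sigma>]" for j w \<sigma>
    proof -
      have "\<sigma> < k" using hw[of j] that(2) by (auto simp: words_def)
      moreover have "stamp k (h j) = stamp k (step (h j))"
        using const[of j] const[of "Suc j"] that(1) by (simp add: t_def hS)
      ultimately show ?thesis using stamp_step[of \<sigma> k w] that(2) hS[of j] by auto
    qed
    have run: "h (j + length y) = y @ x" if "j \<ge> i0" "h j = x @ y" for j x y
      using that
    proof (induction y arbitrary: x j rule: rev_induct)
      case Nil
      then show ?case by simp
    next
      case (snoc a y)
      then have "h (Suc j) = (a # x) @ y" using rot[of j "x @ y" a] by simp
      then show ?case using snoc.IH[of "Suc j" "a # x"] snoc.prems by simp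
    qed
    have "h i0 \<noteq> []" using hw[of i0] n by (auto simp: words_def)
    then obtain w \<sigma> where w: "w @ [\<sigma>] \<in> rotations (h i0)" "closes w \<sigma>"
      using ex_rotation_closes by blast
    obtain x y where "h i0 = x @ y" "w @ [\<sigma>] = y @ x" using w(1) rotations_iff by metis
    then have "h (i0 + length y) = w @ [\<sigma>]" using run[of i0] by simp
    then show False using rot[of "i0 + length y"] w(2) by simp
  qed
  \<comment> \<open>Before the first visit to \<open>?e\<close> the hypothesis of
    \<open>step_in_words\<close> holds, so no earlier step leaves the alphabet.\<close>
  define i where "i = (LEAST i. h i = ?e)"
  have i: "h i = ?e" unfolding i_def using ex by (rule LeastI_ex)
  have less: "h j \<noteq> ?e" if "j < i" for j using that not_less_Least unfolding i_def by blast
  have "h j \<in> words n k" if "j \<le> i" for j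
    using that
  proof (induction j)
    case 0
    then show ?case using r by (simp add: h_def)
  next
    case (Suc j)
    then show ?case using step_in_words[of "h j" n k] less[of j] n hS by simp
  qed
  then show ?thesis using i unfolding h_def by blast
qed

section \<open>Injectivity of the orbit and exhaustion of the words over [k]\<close>

lemma length_orbit: "n \<ge> 1 \<Longrightarrow> length (orbit n i) = n"
proof (induction i)
  case (Suc i)
  then have "orbit n i \<noteq> []" by auto
  then show ?case using Suc by (simp add: orbit_Suc length_step)
qed (simp add: orbit_0)

lemma orbit_not_Nil: "n \<ge> 1 \<Longrightarrow> orbit n i \<noteq> []"
  using length_orbit[of n i] by auto

text \<open>Cancelling \<open>step\<close> on both sides leads back to the zero word, which has no
  preimage.\<close>

lemma inj_orbit:
  assumes "n \<ge> 1"
  shows "inj (orbit n)"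
proof -
  have "i = j" if "orbit n i = orbit n j" for i j
    using that
  proof (induction i arbitrary: j)
    case 0
    then show ?case
      by (metis assms not0_implies_Suc orbit_0 orbit_Suc orbit_not_Nil step_neq_zero)
  next
    case (Suc i)
    then show ?case
      by (metis assms not0_implies_Suc orbit_0 orbit_Suc orbit_not_Nil step_inj step_neq_zero)
  qed
  then show ?thesis by (auto intro: injI)
qed

text \<open>\<open>step\<close> is cancelled \<open>i\<close> times. The zero word has no preimage,
  which forces i \<le> j, so the subtraction is not truncated.\<close>

lemma funpow_step_eq_orbit:
  assumes "n \<ge> 1" "length r = n" "(step ^^ i) r = orbit n j"
  shows "r = orbit n (j - i)"
  using assms(3)
proof (induction i arbitrary: j)
  case 0
  then show ?case by simp
next
  case (Suc i)
  have len: "length ((step ^^ i) r) = n" for i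
  proof (induction i)
    case (Suc i)
    then have "(step ^^ i) r \<noteq> []" using assms(1) by auto
    then show ?case using Suc length_step by simp
  qed (simp add: assms(2))
  have ne: "(step ^^ i) r \<noteq> []" using len[of i] assms(1) by auto
  have e: "step ((step ^^ i) r) = orbit n j" using Suc.prems by simp
  then obtain j' where j: "j = Suc j'"
    using step_neq_zero[OF ne, of n] by (cases j) (auto simp: orbit_0)
  then have "step ((step ^^ i) r) = step (orbit n j')" using e by (simp add: orbit_Suc)
  then have "(step ^^ i) r = orbit n j'" by (rule step_inj[OF _ ne orbit_not_Nil[OF assms(1)]])
  then show ?case using Suc.IH j by simp
qed

text \<open>Every word over [k] reaches the same end word as the zero word does; going back from
  there by injectivity places it on the orbit.\<close>

lemma words_eq_orbit:
  assumes "n \<ge> 1" "k \<ge> 1"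
  obtains N where "words n k = orbit n ` {..N}" "orbit n N = replicate (n - 1) 0 @ [k - 1]"
proof -
  have "replicate n 0 \<in> words n k" using assms by (auto simp: words_def)
  then obtain N where N: "orbit n N = replicate (n - 1) 0 @ [k - 1]"
    and sub: "\<forall>j\<le>N. orbit n j \<in> words n k"
    using reaches_end[OF assms(1)] unfolding orbit_def by blast
  have "r \<in> orbit n ` {..N}" if r: "r \<in> words n k" for r
  proof -
    obtain i where "(step ^^ i) r = orbit n N" using reaches_end[OF assms(1) r] N by auto
    moreover have "length r = n" using r by (simp add: words_def)
    ultimately have "r = orbit n (N - i)" using funpow_step_eq_orbit assms(1) by blast
    then show ?thesis by auto
  qed
  then show ?thesis using that N sub by blast
qed

lemma orbit_stamp_mono:
  assumes "n \<ge> 1" "words n k = orbit n ` {..N}" "i \<le> j" "j \<le> N"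
  shows "stamp k (orbit n i) \<le> stamp k (orbit n j)"
  using assms(3,4)
proof (induction j rule: dec_induct)
  case (step j)
  then have "orbit n j \<in> words n k" using assms(2) by auto
  then show ?case using stamp_step_words[OF _ assms(1)] step orbit_Suc
    by (metis Suc_leD order_trans)
qed simp

section \<open>The greedy algorithm runs the orbit backwards\<close>

lemma greedy_choice:
  assumes n: "n \<ge> 1" and W: "words n k = orbit n ` {..N}" and M: "Suc M \<le> N"
  shows "Max {\<tau>. \<tau> < k \<and> butlast (orbit n M) @ [\<tau>] \<notin> orbit n ` {Suc M..N}} = last (orbit n M)"
    and "last (orbit n M) \<in> {\<tau>. \<tau> < k \<and> butlast (orbit n M) @ [\<tau>] \<notin> orbit n ` {Suc M..N}}"
proof -
  let ?w = "butlast (orbit n M)" and ?\<rho> = "last (orbit n M)"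
  let ?F = "{\<tau>. \<tau> < k \<and> ?w @ [\<tau>] \<notin> orbit n ` {Suc M..N}}"
  have wr: "?w @ [?\<rho>] = orbit n M" using orbit_not_Nil[OF n] by simp
  have "orbit n M \<in> words n k" using W M by auto
  then have wk: "?w @ [?\<rho>] \<in> words n k" using wr by simp
  then have rk: "?\<rho> < k" by (simp add: words_def)
  have "orbit n M \<notin> orbit n ` {Suc M..N}" using injD[OF inj_orbit[OF n]] by fastforce
  then show mem: "?\<rho> \<in> ?F" using rk wr by simp
  have "\<tau> \<le> ?\<rho>" if "\<tau> \<in> ?F" for \<tau>
  proof (rule ccontr)
    assume "\<not> \<tau> \<le> ?\<rho>"
    then have lt: "stamp k (orbit n M) < stamp k (?w @ [\<tau>])"
      using stamp_less[of ?\<rho> \<tau> k ?w] wr by simp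
    have "?w @ [\<tau>] \<in> words n k" using wk that by (auto simp: words_def)
    then obtain j where j: "j \<le> N" "?w @ [\<tau>] = orbit n j" using W by auto
    then have "\<not> j \<le> M"
      using orbit_stamp_mono[OF n W, of j M] lt M by auto
    then show False using that j by auto
  qed
  then show "Max ?F = ?\<rho>" using mem by (intro Max_eqI) auto
qed

text \<open>The loop state is always the orbit from index \<open>N\<close> down to some
  \<open>M\<close>. Induction on \<open>M\<close> unfolds the loop from each such state to its end,
  which also settles termination.\<close>

lemma pmx_eq_orbit:
  assumes n: "n \<ge> 1" and k: "k \<ge> 1"
    and W: "words n k = orbit n ` {..N}" and e: "orbit n N = replicate (n - 1) 0 @ [k - 1]"
  shows "pmx n k = map (orbit n) (rev [0..<Suc N])"
proof -
  let ?ws = "\<lambda>M. map (orbit n) (rev [M..<Suc N])"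
  let ?b = "\<lambda>ws. free_symbols k ws \<noteq> {}"
  let ?c = "\<lambda>ws. ws @ [tl (last ws) @ [Max (free_symbols k ws)]]"
  have last: "last (?ws M) = orbit n M" if "M \<le> N" for M
    using that by (simp add: last_map last_rev upt_conv_Cons del: upt_Suc)
  have set: "set (?ws M) = orbit n ` {M..N}" for M
    by (simp add: atLeastLessThanSuc_atLeastAtMost del: upt_Suc)
  have "while ?b ?c (?ws M) = ?ws 0" if "M \<le> N" for M
    using that
  proof (induction M)
    case 0
    \<comment> \<open>At index 0 all words over [k] have been used, so no extension is free.\<close>
    have "free_symbols k (?ws 0) = {}"
    proof (rule equals0I)
      fix \<tau> assume t: "\<tau> \<in> free_symbols k (?ws 0)"
      have "tl (replicate n 0) @ [\<tau>] \<in> words n k"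
        using t n k by (auto simp: free_symbols_def words_def)
      then show False
        using t last[of 0] set[of 0] W
        by (simp add: free_symbols_def orbit_0 atMost_atLeast0 del: upt_Suc)
    qed
    then show ?case by (subst while_unfold) simp
  next
    case (Suc M)
    have tl: "tl (orbit n (Suc M)) = butlast (orbit n M)" by (simp add: orbit_Suc step_def)
    have F: "free_symbols k (?ws (Suc M)) =
        {\<tau>. \<tau> < k \<and> butlast (orbit n M) @ [\<tau>] \<notin> orbit n ` {Suc M..N}}"
      using last[OF Suc.prems] set[of "Suc M"] tl by (simp add: free_symbols_def del: upt_Suc)
    have b: "?b (?ws (Suc M))" using greedy_choice(2)[OF n W Suc.prems] F by blast
    have "?c (?ws (Suc M)) = ?ws (Suc M) @ [orbit n M]"
      using last[OF Suc.prems] greedy_choice(1)[OF n W Suc.prems] F tl orbit_not_Nil[OF n]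
      by simp
    also have "\<dots> = ?ws M" using Suc.prems by (simp add: upt_conv_Cons[of M] del: upt_Suc)
    finally show ?case using Suc b by (subst while_unfold) simp
  qed
  from this[of N] show ?thesis unfolding pmx_def by (simp add: e)
qed

text \<open>Reversing both list and words makes each \<open>rev_pmx n k\<close> an initial segment
  of one sequence that does not depend on \<open>k\<close>.\<close>

lemma rev_pmx_less_iff:
  assumes n: "n \<ge> 1"
  shows "rev_pmx_less n u v \<longleftrightarrow> (\<exists>i j. i < j \<and> u = rev (orbit n i) \<and> v = rev (orbit n j))"
proof -
  have rp: "\<exists>N. words n k = orbit n ` {..N} \<and> rev_pmx n k = map (rev \<circ> orbit n) [0..<Suc N]"
    if k: "k \<ge> 1" for k
  proof -
    obtain N where "words n k = orbit n ` {..N}" "orbit n N = replicate (n - 1) 0 @ [k - 1]"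
      using words_eq_orbit[OF n k] by blast
    then show ?thesis using pmx_eq_orbit[OF n k]
      by (auto simp: rev_pmx_def rev_map simp del: upt_Suc)
  qed
  show ?thesis
  proof
    assume "rev_pmx_less n u v"
    then obtain k i j where "k \<ge> 1" "i < j" "j < length (rev_pmx n k)"
      "rev_pmx n k ! i = u" "rev_pmx n k ! j = v"
      unfolding rev_pmx_less_def by blast
    moreover obtain N where "rev_pmx n k = map (rev \<circ> orbit n) [0..<Suc N]"
      using rp \<open>k \<ge> 1\<close> by blast
    ultimately show "\<exists>i j. i < j \<and> u = rev (orbit n i) \<and> v = rev (orbit n j)"
      by (auto simp del: upt_Suc)
  next
    assume "\<exists>i j. i < j \<and> u = rev (orbit n i) \<and> v = rev (orbit n j)"
    then obtain i j where ij: "i < j" "u = rev (orbit n i)" "v = rev (orbit n j)" by blast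
    \<comment> \<open>The alphabet is chosen to contain every symbol of \<open>orbit n j\<close>;
      injectivity then puts \<open>j\<close> inside the initial segment for
      \<open>k\<close>.\<close>
    define k where "k = Suc (Max (insert 0 (set (orbit n j))))"
    have "orbit n j \<in> words n k"
      using length_orbit[OF n] by (auto simp: words_def k_def less_Suc_eq_le)
    moreover have "k \<ge> 1" by (simp add: k_def)
    moreover from this obtain N where N: "words n k = orbit n ` {..N}"
      "rev_pmx n k = map (rev \<circ> orbit n) [0..<Suc N]" using rp by blast
    ultimately have "j \<le> N" using injD[OF inj_orbit[OF n]] by fastforce
    then show "rev_pmx_less n u v"
      unfolding rev_pmx_less_def using ij \<open>k \<ge> 1\<close> N(2)
      by (intro exI[of _ k] conjI exI[of _ i] exI[of _ j]) (auto simp del: upt_Suc)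
  qed
qed

theorem theorem7:
  fixes n :: nat and v :: "nat list"
  assumes "n \<ge> 1" and "length v = n"
  shows "immediate_successor (rev_pmx_less n) v (suc v)"
proof -
  define k where "k = Suc (Max (insert 0 (set v)))"
  have "rev v \<in> words n k"
    using assms(2) by (auto simp: words_def k_def less_Suc_eq_le)
  moreover have "k \<ge> 1" by (simp add: k_def)
  then obtain N where "words n k = orbit n ` {..N}"
    using words_eq_orbit[OF assms(1)] by blast
  ultimately obtain i where "rev v = orbit n i" by auto
  then have v: "v = rev (orbit n i)" by (metis rev_rev_ident)
  then have s: "suc v = rev (orbit n (Suc i))"
    by (simp add: suc_rev[OF orbit_not_Nil[OF assms(1)]] orbit_Suc)
  have inj: "orbit n a = orbit n b \<longleftrightarrow> a = b" for a b
    using injD[OF inj_orbit[OF assms(1)]] by blast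
  have less: "rev_pmx_less n (rev (orbit n a)) (rev (orbit n b)) \<longleftrightarrow> a < b" for a b
    unfolding rev_pmx_less_iff[OF assms(1)] by (simp add: inj)
  have "\<not> (rev_pmx_less n v w \<and> rev_pmx_less n w (suc v))" for w
  proof
    assume w: "rev_pmx_less n v w \<and> rev_pmx_less n w (suc v)"
    then obtain m where m: "w = rev (orbit n m)"
      unfolding rev_pmx_less_iff[OF assms(1)] by blast
    then have "i < m" "m < Suc i"
      using w less[of i m] less[of m "Suc i"] v s by auto
    then show False by simp
  qed
  moreover have "rev_pmx_less n v (suc v)" using less[of i "Suc i"] v s by simp
  ultimately show ?thesis unfolding immediate_successor_def by blast
qed

end
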